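(* Let $\tau$ be a finite relational signature and let $\mathcal{P}$ be a property of finite $\tau$-structures. (1) Suppose that $\mathcal{P}$ has an oblivious one-sided induced-sampling tester with sample complexity $s(\varepsilon)$. Then $\mathcal{P}$ has a semi-hereditary witness $(\mathcal{H},M)$ satisfying $M(\varepsilon)\le s(\varepsilon)$. The same tester tests $\mathcal{H}$, and for every $\varepsilon>0$ the property $\mathcal{H}$ admits an $(\varepsilon,\eta(\varepsilon),N(\varepsilon),q(\varepsilon))$-ordered container lemma with $$N(\varepsilon)=s(\varepsilon),\qquad q(\varepsilon)=s(\varepsilon)-1,\qquad \eta(\varepsilon)=\frac{2}{3s(\varepsilon)}.$$ (2) Conversely, suppose that $\mathcal{P}$ has a semi-hereditary witness $(\mathcal{H},M)$ and that, for every $\varepsilon>0$, $\mathcal{H}$ admits an $(\varepsilon,\eta(\varepsilon),N(\varepsilon),q(\varepsilon))$-ordered container lemma. Then $\mathcal{P}$ has an oblivious one-sided induced-sampling tester with sample complexity $$O\!\left(\max\left\{M(\varepsilon/2),\ N(\varepsilon/2),\ \frac{q(\varepsilon/2)+1}{\eta(\varepsilon/2)}\log\left(\frac{q(\varepsilon/2)+1}{\eta(\varepsilon/2)}+2\right)\right\}\right).$$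
   Context: A finite relational signature $\tau$ is a finite list of relation symbols $R$, each with a positive integer arity $a(R)$. A finite $\tau$-structure $\mathcal{A}$ is a finite vertex set $V(\mathcal{A})$ together with relations $R^{\mathcal{A}}\subseteq V(\mathcal{A})^{a(R)}$ for $R\in\tau$. For $U\subseteq V(\mathcal{A})$, the induced substructure $\mathcal{A}[U]$ restricts every relation to tuples with all entries in $U$. A $\tau$-property is a family of finite $\tau$-structures closed under isomorphism; it is hereditary if $\mathcal{A}\in\mathcal{P}$ implies $\mathcal{A}[U]\in\mathcal{P}$ for every $U\subseteq V(\mathcal{A})$. Distance: for $\tau$-structures on the same $n$-element vertex set, $d_\tau(\mathcal{A},\mathcal{B})=\frac1{|\tau|}\sum_{R\in\tau}\frac{|R^{\mathcal{A}}\triangle R^{\mathcal{B}}|}{n^{a(R)}}$. $\mathcal{A}$ is $\varepsilon$-far from $\mathcal{P}$ if the minimum of $d_\tau(\mathcal{A},\mathcal{B})$ over $\mathcal{B}\in\mathcal{P}$ on the same vertex set exceeds $\varepsilon$ (the minimum over the empty set being $+\infty$), and $\varepsilon$-close otherwise. A semi-hereditary witness for $\mathcal{P}$ is a pair $(\mathcal{H},M)$ with $\mathcal{H}\supseteq\mathcal{P}$ a hereditary $\tau$-property and $M:(0,1)\to\mathbb{N}$ such that, for every $\varepsilon>0$, every $\mathcal{A}\in\mathcal{H}$ with $|V(\mathcal{A})|\ge M(\varepsilon)$ is $\varepsilon$-close to $\mathcal{P}$. An oblivious induced-sampling tester for a property consists, for every $\varepsilon>0$, of an integer $s(\varepsilon)$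 and a collection $\mathcal{R}_\varepsilon$ of isomorphism types of $\tau$-structures on $s(\varepsilon)$ vertices. On input $\mathcal{A}$ with $|V(\mathcal{A})|\ge s(\varepsilon)$ it chooses a uniformly random $S\in\binom{V(\mathcal{A})}{s(\varepsilon)}$, reveals $\mathcal{A}[S]$, and rejects iff $\mathcal{A}[S]\in\mathcal{R}_\varepsilon$; if $|V(\mathcal{A})|<s(\varepsilon)$ it may inspect the whole input and decide membership (in the property being tested) exactly. It has one-sided error if it always accepts members of the property; it is sound if it rejects every $\varepsilon$-far input with probability at least $2/3$. A one-sided induced-sampling tester is a sound one with one-sided error; its sample complexity is $s(\varepsilon)$. "The same tester tests $\mathcal{H}$" means that the same sample sizes $s(\varepsilon)$ and rejection families $\mathcal{R}_\varepsilon$ form a one-sided induced-sampling tester for $\mathcal{H}$. Ordered container lemma: $V_{\neq}^{j}$ denotes ordered $j$-tuples of distinct elements of $V$, and $\binom{V}{\le x}$ the subsets of $V$ of size at most $x$. For $\varepsilon,\eta>0$ and integers $N,q\ge0$, a hereditary $\tau$-property $\mathcal{H}$ admits an $(\varepsilon,\eta,N,q)$-ordered container lemma if for every $n\ge N$ and every $n$-vertex $\tau$-structure $\mathcal{A}$ that is $\varepsilon$-far from $\mathcal{H}$ there exist maps $f:\{U\subseteq V(\mathcal{A}):\mathcal{A}[U]\in\mathcal{H}\}\to\bigcup_{j=0}^{q}V(\mathcal{A})_{\neq}^{j}$ and $C:\operatorname{im}(f)\to\binom{V(\mathcal{A})}{\le(1-\eta)n}$ such that every entry of $f(U)$ belongs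 to $U$ and $U\subseteq C(f(U))$. The implied constant in $O(\cdot)$ is absolute. *)

theory Defs
  imports "HOL-Probability.Probability"
begin

text \<open>
  A signature is the list of the arities of its relation symbols; the symbols themselves are the
  indices into this list.  Vertices are natural numbers: properties are closed under isomorphism,
  so nothing is lost by choosing a countably infinite supply of vertices.
\<close>

type_synonym signature = "nat list"

definition is_signature :: "signature \<Rightarrow> bool" where
  "is_signature \<tau> \<longleftrightarrow> (\<forall>a\<in>set \<tau>. 0 < a)"

record rel_struct =
  verts :: "nat set"
  rels :: "nat list set list"

definition is_struct :: "signature \<Rightarrow> rel_struct \<Rightarrow> bool" where
  "is_struct \<tau> A \<longleftrightarrow> finite (verts A) \<and> length (rels A) = length \<tau> \<and>
     (\<forall>i<length \<tau>. rels A ! i \<subseteq> {t. length t = \<tau> ! i \<and> set t \<subseteq> verts A})"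

definition induced :: "rel_struct \<Rightarrow> nat set \<Rightarrow> rel_struct" where
  "induced A U = \<lparr>verts = U, rels = map (\<lambda>R. {t \<in> R. set t \<subseteq> U}) (rels A)\<rparr>"

definition isomorphic :: "rel_struct \<Rightarrow> rel_struct \<Rightarrow> bool" where
  "isomorphic A B \<longleftrightarrow>
     (\<exists>\<phi>. bij_betw \<phi> (verts A) (verts B) \<and> rels B = map (\<lambda>R. map \<phi> ` R) (rels A))"

definition is_property :: "signature \<Rightarrow> rel_struct set \<Rightarrow> bool" where
  "is_property \<tau> P \<longleftrightarrow> (\<forall>A\<in>P. is_struct \<tau> A) \<and>
     (\<forall>A\<in>P. \<forall>B. is_struct \<tau> B \<and> isomorphic A B \<longrightarrow> B \<in> P)"

definition hereditary :: "signature \<Rightarrow> rel_struct set \<Rightarrow> bool" where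
  "hereditary \<tau> P \<longleftrightarrow> is_property \<tau> P \<and> (\<forall>A\<in>P. \<forall>U\<subseteq>verts A. induced A U \<in> P)"

text \<open>
  Only used for structures on the same vertex set.  For the empty vertex set every summand is
  \<open>0 / 0 = 0\<close> since arities are positive; for the empty signature the distance is \<open>0\<close>.
\<close>

definition struct_dist :: "signature \<Rightarrow> rel_struct \<Rightarrow> rel_struct \<Rightarrow> real" where
  "struct_dist \<tau> A B = 1 / real (length \<tau>) *
     (\<Sum>i<length \<tau>. real (card (sym_diff (rels A ! i) (rels B ! i)))
        / real (card (verts A)) ^ (\<tau> ! i))"

text \<open>
  The infimum is over a finite set of structures, hence a minimum unless that set is empty,
  in which case it is \<open>\<infinity>\<close>.
\<close>

definition dist_to_property :: "signature \<Rightarrow> rel_struct \<Rightarrow> rel_struct set \<Rightarrow> ereal" where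
  "dist_to_property \<tau> A P = (INF B\<in>{B \<in> P. verts B = verts A}. ereal (struct_dist \<tau> A B))"

definition far :: "signature \<Rightarrow> real \<Rightarrow> rel_struct \<Rightarrow> rel_struct set \<Rightarrow> bool" where
  "far \<tau> \<epsilon> A P \<longleftrightarrow> dist_to_property \<tau> A P > ereal \<epsilon>"

abbreviation close :: "signature \<Rightarrow> real \<Rightarrow> rel_struct \<Rightarrow> rel_struct set \<Rightarrow> bool" where
  "close \<tau> \<epsilon> A P \<equiv> \<not> far \<tau> \<epsilon> A P"

text \<open>The function \<open>M\<close> is only meaningful on \<open>(0,1)\<close>.\<close>

definition semi_hereditary_witness ::
  "signature \<Rightarrow> rel_struct set \<Rightarrow> rel_struct set \<Rightarrow> (real \<Rightarrow> nat) \<Rightarrow> bool" where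
  "semi_hereditary_witness \<tau> P H M \<longleftrightarrow> hereditary \<tau> H \<and> P \<subseteq> H \<and>
     (\<forall>\<epsilon>\<in>{0<..<1}. \<forall>A\<in>H. M \<epsilon> \<le> card (verts A) \<longrightarrow> close \<tau> \<epsilon> A P)"

text \<open>
  The random verdict (\<open>True\<close> for acceptance) on input \<open>A\<close> of the induced-sampling tester for the
  property \<open>P\<close> with sample size \<open>k\<close> and rejection family \<open>R\<close>.
\<close>

definition verdict :: "rel_struct set \<Rightarrow> nat \<Rightarrow> rel_struct set \<Rightarrow> rel_struct \<Rightarrow> bool pmf" where
  "verdict P k R A =
     (if k \<le> card (verts A)
      then map_pmf (\<lambda>S. induced A S \<notin> R) (pmf_of_set {S. S \<subseteq> verts A \<and> card S = k})
      else return_pmf (A \<in> P))"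

text \<open>
  A collection of isomorphism types of structures on \<open>s \<epsilon>\<close> vertices is represented by the
  isomorphism-closed set of all structures of these types.
\<close>

definition oblivious_tester ::
  "signature \<Rightarrow> (real \<Rightarrow> nat) \<Rightarrow> (real \<Rightarrow> rel_struct set) \<Rightarrow> bool" where
  "oblivious_tester \<tau> s R \<longleftrightarrow>
     (\<forall>\<epsilon>>0. is_property \<tau> (R \<epsilon>) \<and> (\<forall>A\<in>R \<epsilon>. card (verts A) = s \<epsilon>))"

definition one_sided_error ::
  "rel_struct set \<Rightarrow> (real \<Rightarrow> nat) \<Rightarrow> (real \<Rightarrow> rel_struct set) \<Rightarrow> bool" where
  "one_sided_error P s R \<longleftrightarrow>
     (\<forall>\<epsilon>>0. \<forall>A\<in>P. pmf (verdict P (s \<epsilon>) (R \<epsilon>) A) True = 1)"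

definition sound ::
  "signature \<Rightarrow> rel_struct set \<Rightarrow> (real \<Rightarrow> nat) \<Rightarrow> (real \<Rightarrow> rel_struct set) \<Rightarrow> bool" where
  "sound \<tau> P s R \<longleftrightarrow>
     (\<forall>\<epsilon>>0. \<forall>A. is_struct \<tau> A \<and> far \<tau> \<epsilon> A P \<longrightarrow>
        pmf (verdict P (s \<epsilon>) (R \<epsilon>) A) False \<ge> 2 / 3)"

definition one_sided_tester ::
  "signature \<Rightarrow> rel_struct set \<Rightarrow> (real \<Rightarrow> nat) \<Rightarrow> (real \<Rightarrow> rel_struct set) \<Rightarrow> bool" where
  "one_sided_tester \<tau> P s R \<longleftrightarrow>
     oblivious_tester \<tau> s R \<and> one_sided_error P s R \<and> sound \<tau> P s R"

definition ordered_container_lemma ::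
  "signature \<Rightarrow> rel_struct set \<Rightarrow> real \<Rightarrow> real \<Rightarrow> nat \<Rightarrow> nat \<Rightarrow> bool" where
  "ordered_container_lemma \<tau> H \<epsilon> \<eta> N q \<longleftrightarrow> 0 < \<epsilon> \<and> 0 < \<eta> \<and>
     (\<forall>A. is_struct \<tau> A \<and> N \<le> card (verts A) \<and> far \<tau> \<epsilon> A H \<longrightarrow>
       (let D = {U. U \<subseteq> verts A \<and> induced A U \<in> H} in
        \<exists>f C. f \<in> D \<rightarrow> {t. distinct t \<and> set t \<subseteq> verts A \<and> length t \<le> q} \<and>
              C \<in> f ` D \<rightarrow> {W. W \<subseteq> verts A \<and> real (card W) \<le> (1 - \<eta>) * real (card (verts A))} \<and>
              (\<forall>U\<in>D. set (f U) \<subseteq> U \<and> U \<subseteq> C (f U))))"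

end

theory Submission
  imports Defs
begin

text \<open>
  From a tester to a witness.  Let \<open>H\<close> consist of all structures without an induced substructure
  in any rejection family \<open>R \<epsilon>\<close>.  Being defined by forbidden induced substructures, \<open>H\<close> is
  hereditary.  It contains \<open>P\<close> because the tester has one-sided error, and a large member of
  \<open>H\<close> is accepted with certainty, so soundness makes it close to \<open>P\<close>; thus \<open>s\<close> itself serves as
  the threshold \<open>M\<close>.

  The containers of \<open>H\<close> come from a statement about an \<open>s\<close>-uniform hypergraph on \<open>n\<close> vertices
  with at least \<open>\<delta> * (n choose s)\<close> edges (\<open>dense_hypergraph_containers\<close>); here the edges are the
  rejected samples and \<open>\<delta> = 2 / 3\<close>.  Call an edge rich, and call a smaller set rich if at least
  \<open>\<delta> * n / s\<close> vertices extend it to a rich set.  If the empty set were not rich, the hypergraph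
  would have fewer than \<open>\<delta> * (n choose s)\<close> edges (\<open>poor_few_completions\<close>), so it is rich.  An
  independent set \<open>U\<close> contains no edge, hence a maximal rich set \<open>T \<subseteq> U\<close> has fewer than \<open>s\<close>
  elements, and by maximality \<open>U\<close> avoids all of the at least \<open>\<delta> * n / s\<close> vertices extending \<open>T\<close>.
  So \<open>T\<close> is the fingerprint, and the complement of its extending vertices is the container.

  From a witness to a tester.  A large structure \<open>A\<close> that is \<open>\<epsilon>\<close>-far from \<open>P\<close> is
  \<open>\<epsilon> / 2\<close>-far from \<open>H\<close> by the triangle inequality (\<open>far_witness_half\<close>).  The tester
  rejects iff the sample does not induce a member of \<open>H\<close>, which never happens on inputs from
  \<open>P \<subseteq> H\<close> by heredity.  If a sample \<open>S\<close> of size \<open>s\<close>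
  induces a member of \<open>H\<close>, it contains its fingerprint \<open>t\<close> and lies in the container of \<open>t\<close>.
  For a fixed \<open>t\<close> of length \<open>j\<close>, a random \<open>S\<close> conditioned on containing \<open>t\<close> lies in the
  container with probability at most \<open>exp (- \<eta> * (s - j))\<close>, and every \<open>S\<close> contains at most
  \<open>s ^ j\<close> tuples of length \<open>j\<close>.  A union bound (\<open>card_covered_samples_le\<close>) therefore bounds the
  probability of acceptance by the sum of \<open>s ^ j * exp (- \<eta> * (s - j))\<close> over \<open>j \<le> q\<close>, which
  is at most \<open>1 / 3\<close> once \<open>s\<close> is a constant multiple of \<open>y * ln (y + 2)\<close>, where
  \<open>y = (q + 1) / \<eta>\<close> (\<open>union_bound_le_third\<close>).
\<close>

section \<open>Structures, induced substructures, isomorphism\<close>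

lemma is_struct_induced:
  assumes "is_struct \<tau> A" "U \<subseteq> verts A"
  shows "is_struct \<tau> (induced A U)"
  using assms unfolding is_struct_def induced_def by (auto intro: finite_subset)

lemma verts_induced [simp]: "verts (induced A U) = U"
  by (simp add: induced_def)

lemma induced_induced:
  assumes "S \<subseteq> U"
  shows "induced (induced A U) S = induced A S"
  using assms unfolding induced_def by auto

lemma induced_verts:
  assumes "is_struct \<tau> A"
  shows "induced A (verts A) = A"
proof -
  have "map (\<lambda>R. {t \<in> R. set t \<subseteq> verts A}) (rels A) = rels A"
    using assms by (intro map_idI) (fastforce simp: is_struct_def in_set_conv_nth)
  thus ?thesis by (simp add: induced_def)
qed

lemma isomorphic_sym:
  assumes "is_struct \<tau> A" "isomorphic A B"
  shows "isomorphic B A"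
proof -
  obtain \<phi> where \<phi>: "bij_betw \<phi> (verts A) (verts B)"
    and rB: "rels B = map (\<lambda>R. map \<phi> ` R) (rels A)"
    using assms(2) by (auto simp: isomorphic_def)
  define \<psi> where "\<psi> = inv_into (verts A) \<phi>"
  have "map \<psi> ` map \<phi> ` R = R" if "R \<in> set (rels A)" for R
  proof -
    have "map \<psi> (map \<phi> t) = t" if "t \<in> R" for t
    proof -
      have "set t \<subseteq> verts A"
        using assms(1) \<open>t \<in> R\<close> \<open>R \<in> set (rels A)\<close>
        by (fastforce simp: is_struct_def in_set_conv_nth)
      moreover have "\<psi> (\<phi> x) = x" if "x \<in> verts A" for x
        using \<phi> that by (simp add: \<psi>_def bij_betw_def)
      ultimately show ?thesis by (auto intro!: map_idI)
    qed
    thus ?thesis by (force simp: image_image)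
  qed
  hence "map (\<lambda>R. map \<psi> ` R) (rels B) = rels A"
    by (simp add: rB o_def map_idI)
  moreover have "bij_betw \<psi> (verts B) (verts A)"
    unfolding \<psi>_def using \<phi> by (rule bij_betw_inv_into)
  ultimately show ?thesis
    unfolding isomorphic_def by metis
qed

lemma isomorphic_induced:
  assumes "bij_betw \<phi> (verts A) (verts B)" "rels B = map (\<lambda>R. map \<phi> ` R) (rels A)"
    and A: "is_struct \<tau> A" and S: "S \<subseteq> verts A"
  shows "isomorphic (induced A S) (induced B (\<phi> ` S))"
proof -
  have inj: "inj_on \<phi> (verts A)" using assms(1) by (simp add: bij_betw_def)
  have "{t \<in> map \<phi> ` R. set t \<subseteq> \<phi> ` S} = map \<phi> ` {t \<in> R. set t \<subseteq> S}"
    if "R \<in> set (rels A)" for R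
  proof -
    have "set t \<subseteq> S" if "t \<in> R" "\<phi> ` set t \<subseteq> \<phi> ` S" for t
    proof -
      have "set t \<subseteq> verts A"
        using A \<open>t \<in> R\<close> \<open>R \<in> set (rels A)\<close> by (fastforce simp: is_struct_def in_set_conv_nth)
      thus ?thesis using that(2) S inj by (simp add: inj_on_image_subset_iff)
    qed
    thus ?thesis by (auto 0 3)
  qed
  hence "rels (induced B (\<phi> ` S)) = map (\<lambda>R. map \<phi> ` R) (rels (induced A S))"
    using assms(2) by (simp add: induced_def)
  moreover have "bij_betw \<phi> (verts (induced A S)) (verts (induced B (\<phi> ` S)))"
    using inj S by (auto simp: bij_betw_def inj_on_subset)
  ultimately show ?thesis unfolding isomorphic_def by blast
qed

lemma is_property_is_struct:
  assumes "is_property \<tau> P" "A \<in> P"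
  shows "is_struct \<tau> A"
  using assms unfolding is_property_def by blast

lemma hereditary_is_property:
  assumes "hereditary \<tau> P"
  shows "is_property \<tau> P"
  using assms unfolding hereditary_def by (rule conjunct1)

lemma hereditary_induced:
  assumes "hereditary \<tau> P" "A \<in> P" "U \<subseteq> verts A"
  shows "induced A U \<in> P"
  using assms unfolding hereditary_def by blast

lemma is_property_isomorphic:
  assumes "is_property \<tau> P" "A \<in> P" "is_struct \<tau> B" "isomorphic A B"
  shows "B \<in> P"
  using assms unfolding is_property_def by blast

lemma semi_hereditary_witnessD:
  assumes "semi_hereditary_witness \<tau> P H M"
  shows "hereditary \<tau> H" "P \<subseteq> H"
    and "\<epsilon> \<in> {0<..<1} \<Longrightarrow> A \<in> H \<Longrightarrow> M \<epsilon> \<le> card (verts A) \<Longrightarrow> close \<tau> \<epsilon> A P"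
  using assms unfolding semi_hereditary_witness_def by blast+

section \<open>Distance to a property\<close>

lemma far_subset:
  assumes "far \<tau> \<epsilon> A H" "P \<subseteq> H"
  shows "far \<tau> \<epsilon> A P"
proof -
  have "dist_to_property \<tau> A H \<le> dist_to_property \<tau> A P"
    unfolding dist_to_property_def using assms(2) by (intro INF_superset_mono) auto
  thus ?thesis using assms(1) unfolding far_def by order
qed

lemma far_mono:
  assumes "far \<tau> \<epsilon> A P" "\<delta> \<le> \<epsilon>"
  shows "far \<tau> \<delta> A P"
  using assms unfolding far_def by (meson ereal_less_eq(3) order_le_less_trans)

lemma far_not_mem:
  assumes "far \<tau> \<epsilon> A P" "0 \<le> \<epsilon>"
  shows "A \<notin> P"
proof
  assume "A \<in> P"
  hence "dist_to_property \<tau> A P \<le> ereal (struct_dist \<tau> A A)"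
    unfolding dist_to_property_def by (intro INF_lower) auto
  also have "\<dots> \<le> ereal \<epsilon>" using assms(2) by (simp add: struct_dist_def)
  finally show False using assms(1) by (simp add: far_def)
qed

lemma struct_dist_triangle:
  assumes "is_struct \<tau> A" "is_struct \<tau> B" "is_struct \<tau> C"
    and verts: "verts B = verts A" "verts C = verts A"
  shows "struct_dist \<tau> A C \<le> struct_dist \<tau> A B + struct_dist \<tau> B C"
proof -
  have fin: "finite (rels X ! i)" if "is_struct \<tau> X" "i < length \<tau>" for X i
  proof -
    have "finite {t. set t \<subseteq> verts X \<and> length t = \<tau> ! i}"
      using that by (intro finite_lists_length_eq) (simp add: is_struct_def)
    moreover have "rels X ! i \<subseteq> {t. set t \<subseteq> verts X \<and> length t = \<tau> ! i}"
      using that by (auto simp: is_struct_def)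
    ultimately show ?thesis by (rule rev_finite_subset)
  qed
  have tri: "real (card (sym_diff (rels A ! i) (rels C ! i)))
      \<le> real (card (sym_diff (rels A ! i) (rels B ! i)))
        + real (card (sym_diff (rels B ! i) (rels C ! i)))" if "i < length \<tau>" for i
  proof -
    have "card (sym_diff (rels A ! i) (rels C ! i))
        \<le> card (sym_diff (rels A ! i) (rels B ! i) \<union> sym_diff (rels B ! i) (rels C ! i))"
      using assms that by (intro card_mono) (auto simp: fin)
    also have "\<dots> \<le> card (sym_diff (rels A ! i) (rels B ! i))
        + card (sym_diff (rels B ! i) (rels C ! i))"
      by (rule card_Un_le)
    finally show ?thesis by linarith
  qed
  show ?thesis
    unfolding struct_dist_def distrib_left[symmetric] sum.distrib[symmetric] verts
      add_divide_distrib[symmetric]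
    using tri by (intro mult_left_mono sum_mono divide_right_mono) auto
qed

text \<open>
  Were \<open>A\<close> close to some \<open>B \<in> H\<close>, the witness would give a \<open>C \<in> P\<close> close to \<open>B\<close>, and \<open>A\<close>
  would be close to \<open>C\<close>.  Taking \<open>B\<close> and \<open>C\<close> within \<open>e / 2\<close> of the infima, for every
  \<open>e > 0\<close>, avoids showing that the infima are attained.
\<close>

lemma far_witness_half:
  assumes witness: "semi_hereditary_witness \<tau> P H M" and "is_property \<tau> P"
    and A: "is_struct \<tau> A" "M \<delta> \<le> card (verts A)" "far \<tau> (2 * \<delta>) A P"
    and \<delta>: "\<delta> \<in> {0<..<1}"
  shows "far \<tau> \<delta> A H"
proof (rule ccontr)
  have step: "\<exists>B\<in>Q. verts B = verts X \<and> struct_dist \<tau> X B < \<delta> + e"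
    if "close \<tau> \<delta> X Q" "0 < e" for X Q and e :: real
  proof -
    have "dist_to_property \<tau> X Q < ereal (\<delta> + e)"
      using that unfolding far_def
      by (metis ereal_less_eq(3) less_add_same_cancel1 linorder_not_less order_less_le_trans)
    thus ?thesis unfolding dist_to_property_def by (auto simp: INF_less_iff)
  qed
  assume close: "close \<tau> \<delta> A H"
  have "dist_to_property \<tau> A P \<le> ereal (2 * \<delta>) + ereal e" if "0 < e" for e
  proof -
    obtain B where B: "B \<in> H" "verts B = verts A" "struct_dist \<tau> A B < \<delta> + e / 2"
      using step[OF close, of "e / 2"] \<open>0 < e\<close> by auto
    have "close \<tau> \<delta> B P"
      using semi_hereditary_witnessD(3)[OF witness \<delta> B(1)] A(2) B(2) by simp
    then obtain C where C: "C \<in> P" "verts C = verts B" "struct_dist \<tau> B C < \<delta> + e / 2"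
      using step[of B P "e / 2"] \<open>0 < e\<close> by auto
    have "is_struct \<tau> B" "is_struct \<tau> C"
      using is_property_is_struct[OF hereditary_is_property B(1)]
        semi_hereditary_witnessD(1)[OF witness]
        is_property_is_struct[OF \<open>is_property \<tau> P\<close> C(1)] by blast+
    hence "struct_dist \<tau> A C \<le> 2 * \<delta> + e"
      using struct_dist_triangle[OF A(1), of B C] B C by auto
    moreover have "dist_to_property \<tau> A P \<le> ereal (struct_dist \<tau> A C)"
      unfolding dist_to_property_def using B C by (intro INF_lower) auto
    ultimately show ?thesis by (simp add: order_trans)
  qed
  hence "dist_to_property \<tau> A P \<le> ereal (2 * \<delta>)"
    by (rule ereal_le_epsilon2)
  thus False using A(3) by (simp add: far_def)
qed

section \<open>The verdict as a proportion of samples\<close>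

lemma pmf_verdict:
  assumes "finite (verts A)" "k \<le> card (verts A)"
  shows "pmf (verdict P k R A) b =
    real (card {S. S \<subseteq> verts A \<and> card S = k \<and> (induced A S \<notin> R) = b})
      / real (card (verts A) choose k)"
proof -
  let ?\<Omega> = "{S. S \<subseteq> verts A \<and> card S = k}"
  have fin: "finite ?\<Omega>" using assms(1) by (simp add: finite_subset[of _ "Pow (verts A)"] subset_iff)
  have ne: "?\<Omega> \<noteq> {}" using obtain_subset_with_card_n[OF assms(2)] by blast
  have "pmf (verdict P k R A) b
      = real (card (?\<Omega> \<inter> (\<lambda>S. induced A S \<notin> R) -` {b})) / real (card ?\<Omega>)"
    using assms(2) ne fin by (simp add: verdict_def pmf_map measure_pmf_of_set)
  also have "?\<Omega> \<inter> (\<lambda>S. induced A S \<notin> R) -` {b}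
      = {S. S \<subseteq> verts A \<and> card S = k \<and> (induced A S \<notin> R) = b}" by auto
  finally show ?thesis using n_subsets[OF assms(1), of k] by simp
qed

lemma pmf_verdict_True_eq_1_iff:
  assumes "finite (verts A)" "k \<le> card (verts A)"
  shows "pmf (verdict P k R A) True = 1
    \<longleftrightarrow> (\<forall>S\<subseteq>verts A. card S = k \<longrightarrow> induced A S \<notin> R)"
proof -
  let ?\<Omega> = "{S. S \<subseteq> verts A \<and> card S = k}"
  let ?G = "{S. S \<subseteq> verts A \<and> card S = k \<and> induced A S \<notin> R}"
  have fin: "finite ?\<Omega>" using assms(1) by (simp add: finite_subset[of _ "Pow (verts A)"] subset_iff)
  have pos: "0 < card (verts A) choose k" using assms(2) by simp
  have "pmf (verdict P k R A) True = 1 \<longleftrightarrow> card ?G = card ?\<Omega>"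
    using pos by (auto simp: pmf_verdict[OF assms] n_subsets[OF assms(1)])
  also have "\<dots> \<longleftrightarrow> ?G = ?\<Omega>"
    using card_subset_eq[OF fin, of ?G] by auto
  also have "\<dots> \<longleftrightarrow> (\<forall>S\<subseteq>verts A. card S = k \<longrightarrow> induced A S \<notin> R)" by auto
  finally show ?thesis .
qed

section \<open>Containers for dense uniform hypergraphs\<close>

text \<open>
  Vertex sets \<open>T\<close> that lack \<open>m\<close> elements to become an edge.  The threshold is the natural
  number \<open>k\<close>, exceeded strictly, so that the bound for sets that are not rich stays a
  statement about natural numbers.
\<close>

fun rich :: "'a set \<Rightarrow> 'a set set \<Rightarrow> nat \<Rightarrow> nat \<Rightarrow> 'a set \<Rightarrow> bool" where
  "rich V F k 0 T \<longleftrightarrow> T \<in> F"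
| "rich V F k (Suc m) T \<longleftrightarrow> k < card {v \<in> V - T. rich V F k m (insert v T)}"

definition completions :: "'a set \<Rightarrow> 'a set set \<Rightarrow> nat \<Rightarrow> 'a set \<Rightarrow> 'a set set" where
  "completions V F m T = {X. X \<subseteq> V - T \<and> card X = m \<and> T \<union> X \<in> F}"

lemma finite_completions:
  "finite V \<Longrightarrow> finite (completions V F m T)"
  by (rule finite_subset[of _ "Pow V"]) (auto simp: completions_def)

lemma completions_0:
  assumes "finite V"
  shows "completions V F 0 T = (if T \<in> F then {{}} else {})"
  using assms by (auto simp: completions_def dest: finite_subset)

text \<open>
  Both sides count the completions of size \<open>m + 1\<close> with one distinguished element.
\<close>

lemma card_completions_Suc:
  assumes V: "finite V"
  shows "Suc m * card (completions V F (Suc m) T)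
    = (\<Sum>v\<in>V - T. card (completions V F m (insert v T)))"
proof -
  have finX: "finite X" if "X \<subseteq> V - T'" for X T' using that V by (meson finite_Diff finite_subset)
  let ?L = "SIGMA Y:completions V F (Suc m) T. Y"
  let ?R = "SIGMA v:V - T. completions V F m (insert v T)"
  have "bij_betw (\<lambda>(Y, v). (v, Y - {v})) ?L ?R"
  proof (rule bij_betw_byWitness[where f' = "\<lambda>(v, X). (insert v X, v)"])
    show "\<forall>p\<in>?L. (\<lambda>(v, X). (insert v X, v)) ((\<lambda>(Y, v). (v, Y - {v})) p) = p"
      by auto
    show "\<forall>p\<in>?R. (\<lambda>(Y, v). (v, Y - {v})) ((\<lambda>(v, X). (insert v X, v)) p) = p"
      by (auto simp: completions_def)
    show "(\<lambda>(Y, v). (v, Y - {v})) ` ?L \<subseteq> ?R"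
    proof clarsimp
      fix Y v assume Y: "Y \<in> completions V F (Suc m) T" and v: "v \<in> Y"
      have "insert v T \<union> (Y - {v}) = T \<union> Y" using v by auto
      thus "v \<in> V \<and> v \<notin> T \<and> Y - {v} \<in> completions V F m (insert v T)"
        using Y v finX[of Y T] by (auto simp: completions_def)
    qed
    show "(\<lambda>(v, X). (insert v X, v)) ` ?R \<subseteq> ?L"
    proof clarsimp
      fix v X assume v: "v \<in> V" "v \<notin> T" and X: "X \<in> completions V F m (insert v T)"
      have "v \<notin> X" "finite X" using X finX[of X "insert v T"] by (auto simp: completions_def)
      thus "insert v X \<in> completions V F (Suc m) T"
        using X v by (auto simp: completions_def)
    qed
  qed
  hence "card ?L = card ?R" by (rule bij_betw_same_card)
  moreover have "card ?L = (\<Sum>Y\<in>completions V F (Suc m) T. card Y)"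
    using V by (intro card_SigmaI ballI)
      (auto simp: finite_completions completions_def dest: finX)
  moreover have "\<dots> = Suc m * card (completions V F (Suc m) T)"
    by (simp add: completions_def)
  moreover have "card ?R = (\<Sum>v\<in>V - T. card (completions V F m (insert v T)))"
    using V by (intro card_SigmaI) (auto simp: finite_completions)
  ultimately show ?thesis by simp
qed

lemma card_completions_le:
  assumes "finite V" "T \<subseteq> V"
  shows "card (completions V F m T) \<le> (card V - card T) choose m"
proof -
  have "finite {X. X \<subseteq> V - T \<and> card X = m}"
    by (rule finite_subset[of _ "Pow V"]) (use assms(1) in auto)
  hence "card (completions V F m T) \<le> card {X. X \<subseteq> V - T \<and> card X = m}"
    by (rule card_mono) (auto simp: completions_def)
  also have "\<dots> = card (V - T) choose m"
    using assms(1) by (intro n_subsets) simp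
  also have "card (V - T) = card V - card T"
    using assms(2) finite_subset[OF assms(2,1)] by (rule card_Diff_subset[rotated])
  finally show ?thesis .
qed

text \<open>
  The bound is a union bound in disguise: \<open>k * (N - 1 choose m)\<close> bounds the number of
  \<open>(m + 1)\<close>-subsets of an \<open>N\<close>-set that meet a fixed \<open>k\<close>-set, and a set that is not rich behaves
  no worse than if its completions were exactly these.  Counting the exact number of
  completions instead of conditional densities makes the bound lossless under sampling
  without replacement; no term in the number of vertices already chosen accumulates.
\<close>

lemma poor_few_completions:
  assumes V: "finite V" and "T \<subseteq> V" "card T + Suc m \<le> card V"
    and "\<not> rich V F k (Suc m) T"
  shows "card (completions V F (Suc m) T) \<le> k * ((card V - card T - 1) choose m)"
  using assms(2-)
proof (induction m arbitrary: T)
  case 0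
  have "card (completions V F (Suc 0) T) = (\<Sum>v\<in>V - T. card (completions V F 0 (insert v T)))"
    using card_completions_Suc[OF V, of 0 F T] by simp
  also have "\<dots> = (\<Sum>v\<in>V - T. if insert v T \<in> F then 1 else 0)"
    by (intro sum.cong) (auto simp: completions_0[OF V])
  also have "\<dots> = card {v \<in> V - T. insert v T \<in> F}"
    using V by (simp add: sum.If_cases Int_def)
  finally show ?case using 0 by simp
next
  case (Suc l)
  \<comment> \<open>Of the \<open>M + 2\<close> vertices outside \<open>T\<close>, an extension \<open>insert v T\<close> leaves \<open>M + 1\<close>, and the
      induction hypothesis for it speaks of \<open>M\<close>.\<close>
  define M where "M = card V - card T - 2"
  define G where "G = {v \<in> V - T. rich V F k (Suc l) (insert v T)}"
  have finT: "finite T" using Suc.prems(1) V finite_subset by auto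
  have cVT: "card (V - T) = M + 2"
    using Suc.prems(1,2) finT by (simp add: M_def card_Diff_subset)
  have G: "G \<subseteq> V - T" "card G \<le> k" "finite G"
    using Suc.prems(3) V by (auto simp: G_def)
  have ci: "card (insert v T) = Suc (card T)" if "v \<in> V - T" for v
    using that finT by simp
  have rich_le: "card (completions V F (Suc l) (insert v T)) \<le> Suc M choose Suc l"
    if "v \<in> G" for v
    using card_completions_le[OF V, of "insert v T" F "Suc l"] that Suc.prems(1,2) G(1) ci[of v]
    by (auto simp: M_def Suc_diff_Suc numeral_2_eq_2)
  have poor_le: "card (completions V F (Suc l) (insert v T)) \<le> k * (M choose l)"
    if "v \<in> V - T - G" for v
    using Suc.IH[of "insert v T"] that Suc.prems(1,2) ci[of v]
    by (auto simp: M_def G_def numeral_2_eq_2)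
  have "Suc (Suc l) * card (completions V F (Suc (Suc l)) T)
      = (\<Sum>v\<in>V - T. card (completions V F (Suc l) (insert v T)))"
    by (rule card_completions_Suc[OF V])
  also have "\<dots> = (\<Sum>v\<in>G. card (completions V F (Suc l) (insert v T)))
      + (\<Sum>v\<in>V - T - G. card (completions V F (Suc l) (insert v T)))"
    using V G(1) by (subst sum.subset_diff[of G]) auto
  also have "\<dots> \<le> card G * (Suc M choose Suc l) + card (V - T - G) * (k * (M choose l))"
    using sum_bounded_above[of G, OF rich_le] sum_bounded_above[of "V - T - G", OF poor_le]
    by (intro add_mono) auto
  also have "card (V - T - G) = M + 2 - card G"
    using cVT G by (simp add: card_Diff_subset)
  also have "card G * (Suc M choose Suc l) + (M + 2 - card G) * (k * (M choose l))
      \<le> Suc (Suc l) * (k * (Suc M choose Suc l))"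
  proof -
    have absorb: "Suc M * (k * (M choose l)) = Suc l * (k * (Suc M choose Suc l))"
      using Suc_times_binomial_eq[of M l] by (simp add: algebra_simps)
    show ?thesis
    proof (cases "card G = 0")
      case True
      \<comment> \<open>Without extending vertices there are \<open>M + 2\<close> rather than at most \<open>M + 1\<close> poor ones;
          the surplus summand is paid for by the slack \<open>k * (Suc M choose Suc l)\<close>.\<close>
      have "M choose l \<le> Suc M choose Suc l" by simp
      hence "k * (M choose l) \<le> k * (Suc M choose Suc l)" by (rule mult_le_mono2)
      hence "(M + 2) * (k * (M choose l)) \<le> Suc (Suc l) * (k * (Suc M choose Suc l))"
        using absorb by (simp only: add_2_eq_Suc' mult_Suc)
      thus ?thesis using True by simp
    next
      case False
      have "card G * (Suc M choose Suc l) \<le> k * (Suc M choose Suc l)"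
        using G(2) by (rule mult_le_mono1)
      moreover have "(M + 2 - card G) * (k * (M choose l)) \<le> Suc M * (k * (M choose l))"
        using False by (intro mult_le_mono1) auto
      ultimately show ?thesis using absorb by (simp only: mult_Suc)
    qed
  qed
  finally have "card (completions V F (Suc (Suc l)) T) \<le> k * (Suc M choose Suc l)"
    by (simp only: mult_le_cancel1 zero_less_Suc simp_thms)
  moreover have "card V - card T - 1 = Suc M"
    using Suc.prems(2) by (simp add: M_def)
  ultimately show ?case by simp
qed

text \<open>
  Otherwise there are at most \<open>k * (n - 1 choose s - 1) = (k * s / n) * (n choose s)\<close> edges,
  fewer than assumed.
\<close>

lemma rich_empty_if_dense:
  assumes V: "finite V" and s: "0 < s" "s \<le> card V"
    and F: "F \<subseteq> {S. S \<subseteq> V \<and> card S = s}"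
    and dense: "\<delta> * real (card V choose s) \<le> real (card F)"
    and k: "real k * real s < \<delta> * real (card V)"
  shows "rich V F k s {}"
proof (rule ccontr)
  assume poor: "\<not> rich V F k s {}"
  obtain m where m: "s = Suc m" using s(1) by (cases s) auto
  obtain n where n: "card V = Suc n" using s by (cases "card V") auto
  have pos: "0 < real (Suc n choose Suc m)" using s(2) m n by (simp del: binomial_Suc_Suc)
  have "completions V F s {} = F" using F by (auto simp: completions_def)
  hence "card F \<le> k * (n choose m)"
    using poor_few_completions[OF V, of "{}" m F k] poor s m n by simp
  hence "real (Suc n) * real (card F) \<le> real k * real (Suc n * (n choose m))"
    by (metis (no_types, opaque_lifting) mult.left_commute mult_le_mono2 of_nat_le_iff of_nat_mult)
  also have "\<dots> = real k * real s * real (Suc n choose Suc m)"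
    unfolding Suc_times_binomial_eq m by (simp only: of_nat_mult mult_ac)
  also have "\<dots> < \<delta> * real (Suc n) * real (Suc n choose Suc m)"
    using k pos unfolding n by (rule mult_strict_right_mono)
  also have "\<dots> = real (Suc n) * (\<delta> * real (Suc n choose Suc m))" by simp
  also have "\<dots> \<le> real (Suc n) * real (card F)"
    using dense unfolding n m by (rule mult_left_mono) simp
  finally show False by simp
qed

text \<open>
  A rich set with \<open>s\<close> elements is an edge, so an independent \<open>U\<close> has only smaller rich
  subsets; take a maximal one.
\<close>

lemma maximal_rich_subset:
  assumes "rich V F k s {}" "finite U" and indep: "\<And>S. S \<in> F \<Longrightarrow> \<not> S \<subseteq> U"
  shows "\<exists>T\<subseteq>U. card T < s \<and> rich V F k (s - card T) T
    \<and> (\<forall>v\<in>U - T. \<not> rich V F k (s - card T - 1) (insert v T))"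
proof -
  define Q where "Q = {T. T \<subseteq> U \<and> card T \<le> s \<and> rich V F k (s - card T) T}"
  have "{} \<in> Q" "finite Q"
    using assms(1,2) by (auto simp: Q_def finite_subset[of _ "Pow U"] subset_iff)
  then obtain T where T: "T \<in> Q" and mx: "\<And>T'. T' \<in> Q \<Longrightarrow> T \<subseteq> T' \<Longrightarrow> T' = T"
    using finite_has_maximal2[of Q "{}"] by (metis (no_types, lifting))
  have "card T \<noteq> s" using T indep[of T] by (auto simp: Q_def)
  hence lt: "card T < s" using T by (auto simp: Q_def)
  have finT: "finite T" using T assms(2) finite_subset by (auto simp: Q_def)
  have "\<not> rich V F k (s - card T - 1) (insert v T)" if "v \<in> U - T" for v
  proof
    assume "rich V F k (s - card T - 1) (insert v T)"
    hence "insert v T \<in> Q" using that T lt finT by (auto simp: Q_def)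
    thus False using mx[of "insert v T"] that by auto
  qed
  thus ?thesis using T lt by (auto simp: Q_def)
qed

text \<open>
  The container is a function of the fingerprint \<open>g U\<close> alone: the vertices that extend the
  fingerprint to a rich set are determined by it, and the container is what they leave.
\<close>

lemma dense_hypergraph_containers:
  assumes V: "finite V" and s: "0 < s" "s \<le> card V"
    and F: "F \<subseteq> {S. S \<subseteq> V \<and> card S = s}"
    and dense: "\<delta> * real (card V choose s) \<le> real (card F)" and \<delta>: "0 < \<delta>"
  obtains g C where "\<And>U. U \<subseteq> V \<Longrightarrow> (\<And>S. S \<in> F \<Longrightarrow> \<not> S \<subseteq> U) \<Longrightarrow>
      g U \<subseteq> U \<and> card (g U) < s \<and> U \<subseteq> C (g U) \<and> C (g U) \<subseteq> V
      \<and> real (card (C (g U))) \<le> (1 - \<delta> / real s) * real (card V)"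
proof -
  define \<kappa> where "\<kappa> = \<delta> * real (card V) / real s"
  \<comment> \<open>The largest natural number below \<open>\<kappa>\<close>: having more than \<open>k\<close> extensions is having at least \<open>\<kappa>\<close>.\<close>
  define k where "k = nat (\<lceil>\<kappa>\<rceil> - 1)"
  have "0 < \<kappa>" using s \<delta> by (simp add: \<kappa>_def)
  hence k: "real k < \<kappa>" "\<kappa> \<le> real k + 1" unfolding k_def by linarith+
  have "rich V F k s {}"
    using k(1) s(1) by (intro rich_empty_if_dense[OF V s F dense]) (simp add: \<kappa>_def field_simps)
  define ext where "ext T = {v \<in> V - T. rich V F k (s - card T - 1) (insert v T)}" for T
  have "\<exists>T\<subseteq>U. card T < s \<and> U \<subseteq> V - ext T
      \<and> real (card (V - ext T)) \<le> (1 - \<delta> / real s) * real (card V)"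
    if U: "U \<subseteq> V" "\<And>S. S \<in> F \<Longrightarrow> \<not> S \<subseteq> U" for U
  proof -
    obtain T where T: "T \<subseteq> U" "card T < s" "rich V F k (s - card T) T"
        "\<forall>v\<in>U - T. \<not> rich V F k (s - card T - 1) (insert v T)"
      using maximal_rich_subset[OF \<open>rich V F k s {}\<close> _ U(2)] U(1) V finite_subset by metis
    have "Suc (s - card T - 1) = s - card T" using T(2) by simp
    hence "k < card (ext T)"
      using T(3) rich.simps(2)[of V F k "s - card T - 1" T] by (simp add: ext_def)
    moreover have "card (V - ext T) = card V - card (ext T)" "card (ext T) \<le> card V"
      using V by (auto simp: ext_def card_Diff_subset intro!: card_mono)
    ultimately have "real (card (V - ext T)) \<le> real (card V) - \<kappa>" using k(2) by linarith
    also have "\<dots> = (1 - \<delta> / real s) * real (card V)" by (simp add: \<kappa>_def algebra_simps)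
    finally show ?thesis using T U(1) by (intro exI[of _ T]) (auto simp: ext_def)
  qed
  hence "\<exists>g. \<forall>U. U \<subseteq> V \<longrightarrow> (\<forall>S\<in>F. \<not> S \<subseteq> U) \<longrightarrow> (g U \<subseteq> U \<and> card (g U) < s
      \<and> U \<subseteq> V - ext (g U)
      \<and> real (card (V - ext (g U))) \<le> (1 - \<delta> / real s) * real (card V))"
    by (intro choice) metis
  then obtain g where "\<forall>U. U \<subseteq> V \<longrightarrow> (\<forall>S\<in>F. \<not> S \<subseteq> U) \<longrightarrow> (g U \<subseteq> U \<and> card (g U) < s
      \<and> U \<subseteq> V - ext (g U)
      \<and> real (card (V - ext (g U))) \<le> (1 - \<delta> / real s) * real (card V))" ..
  thus thesis by (intro that[of g "\<lambda>T. V - ext T"]) auto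
qed

section \<open>From a tester to a witness with containers\<close>

definition rejection_free :: "signature \<Rightarrow> (real \<Rightarrow> nat) \<Rightarrow> (real \<Rightarrow> rel_struct set) \<Rightarrow> rel_struct set"
  where "rejection_free \<tau> s R = {A. is_struct \<tau> A \<and>
    (\<forall>\<epsilon>>0. \<forall>S\<subseteq>verts A. card S = s \<epsilon> \<longrightarrow> induced A S \<notin> R \<epsilon>)}"

lemma hereditary_rejection_free:
  assumes "oblivious_tester \<tau> s R"
  shows "hereditary \<tau> (rejection_free \<tau> s R)"
proof -
  have "B \<in> rejection_free \<tau> s R"
    if A: "A \<in> rejection_free \<tau> s R" and B: "is_struct \<tau> B" and iso: "isomorphic A B" for A B
  proof -
    have sA: "is_struct \<tau> A" using A by (simp add: rejection_free_def)
    obtain \<psi> where \<psi>: "bij_betw \<psi> (verts B) (verts A)" "rels A = map (\<lambda>R. map \<psi> ` R) (rels B)"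
      using isomorphic_sym[OF sA iso] by (auto simp: isomorphic_def)
    have "induced B S \<notin> R \<epsilon>" if "0 < \<epsilon>" "S \<subseteq> verts B" "card S = s \<epsilon>" for \<epsilon> S
    proof
      assume mem: "induced B S \<in> R \<epsilon>"
      have sub: "\<psi> ` S \<subseteq> verts A" using \<psi>(1) that(2) by (auto simp: bij_betw_def)
      have iso': "isomorphic (induced B S) (induced A (\<psi> ` S))"
        using isomorphic_induced[OF \<psi> B that(2)] .
      have "is_property \<tau> (R \<epsilon>)"
        using assms that(1) by (simp add: oblivious_tester_def)
      hence "induced A (\<psi> ` S) \<in> R \<epsilon>"
        using mem is_struct_induced[OF sA sub] iso' by (rule is_property_isomorphic)
      moreover have "card (\<psi> ` S) = s \<epsilon>"
        using \<psi>(1) that by (metis bij_betw_def card_image inj_on_subset)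
      ultimately show False using A that(1) sub by (simp add: rejection_free_def)
    qed
    thus ?thesis using B by (simp add: rejection_free_def)
  qed
  moreover have "induced A U \<in> rejection_free \<tau> s R"
    if "A \<in> rejection_free \<tau> s R" "U \<subseteq> verts A" for A U
    using that by (auto simp: rejection_free_def is_struct_induced induced_induced)
  moreover have "is_struct \<tau> A" if "A \<in> rejection_free \<tau> s R" for A
    using that by (simp add: rejection_free_def)
  ultimately show ?thesis
    unfolding hereditary_def is_property_def by blast
qed

lemma pmf_verdict_rejection_free:
  assumes "A \<in> rejection_free \<tau> s R" "0 < \<epsilon>" "s \<epsilon> \<le> card (verts A)"
  shows "pmf (verdict Q (s \<epsilon>) (R \<epsilon>) A) True = 1"
proof -
  have "finite (verts A)" using assms(1) by (simp add: rejection_free_def is_struct_def)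
  thus ?thesis using assms by (simp add: pmf_verdict_True_eq_1_iff rejection_free_def)
qed

lemma subset_rejection_free:
  assumes "is_property \<tau> P" "one_sided_tester \<tau> P s R"
  shows "P \<subseteq> rejection_free \<tau> s R"
proof
  fix A assume A: "A \<in> P"
  hence sA: "is_struct \<tau> A" and fin: "finite (verts A)"
    using is_property_is_struct[OF assms(1)] by (auto simp: is_struct_def)
  have "induced A S \<notin> R \<epsilon>" if "0 < \<epsilon>" "S \<subseteq> verts A" "card S = s \<epsilon>" for \<epsilon> S
  proof -
    have "s \<epsilon> \<le> card (verts A)" using that fin card_mono by metis
    moreover have "pmf (verdict P (s \<epsilon>) (R \<epsilon>) A) True = 1"
      using assms(2) A that(1) by (simp add: one_sided_tester_def one_sided_error_def)
    ultimately show ?thesis using that fin by (simp add: pmf_verdict_True_eq_1_iff)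
  qed
  thus "A \<in> rejection_free \<tau> s R" using sA by (simp add: rejection_free_def)
qed

text \<open>
  An input accepted with certainty cannot be far from \<open>P\<close>, since a far input is rejected with
  probability at least \<open>2 / 3\<close>.
\<close>

lemma witness_rejection_free:
  assumes "is_property \<tau> P" "one_sided_tester \<tau> P s R"
  shows "semi_hereditary_witness \<tau> P (rejection_free \<tau> s R) s"
proof -
  have "close \<tau> \<epsilon> A P"
    if "0 < \<epsilon>" and A: "A \<in> rejection_free \<tau> s R" and "s \<epsilon> \<le> card (verts A)" for \<epsilon> A
  proof
    assume "far \<tau> \<epsilon> A P"
    hence "2 / 3 \<le> pmf (verdict P (s \<epsilon>) (R \<epsilon>) A) False"
      using assms(2) that by (simp add: one_sided_tester_def sound_def rejection_free_def)
    moreover have "pmf (verdict P (s \<epsilon>) (R \<epsilon>) A) True = 1"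
      using pmf_verdict_rejection_free[OF A that(1,3)] .
    ultimately show False using pmf_False_conv_True[of "verdict P (s \<epsilon>) (R \<epsilon>) A"] by simp
  qed
  thus ?thesis
    using subset_rejection_free[OF assms] hereditary_rejection_free[of \<tau> s R] assms(2)
    by (simp add: semi_hereditary_witness_def one_sided_tester_def)
qed

text \<open>
  Soundness is inherited because an input far from the larger property is far from \<open>P\<close>.
  Inputs smaller than the sample are decided exactly, now with respect to the larger property.
\<close>

lemma tester_rejection_free:
  assumes "is_property \<tau> P" "one_sided_tester \<tau> P s R"
  shows "one_sided_tester \<tau> (rejection_free \<tau> s R) s R"
proof -
  let ?H = "rejection_free \<tau> s R"
  have "one_sided_error ?H s R"
    unfolding one_sided_error_def
  proof (intro allI impI ballI)
    fix \<epsilon> :: real and A assume "0 < \<epsilon>" "A \<in> ?H"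
    thus "pmf (verdict ?H (s \<epsilon>) (R \<epsilon>) A) True = 1"
      using pmf_verdict_rejection_free[of A \<tau> s R \<epsilon> ?H]
      by (cases "s \<epsilon> \<le> card (verts A)") (auto simp: verdict_def)
  qed
  moreover have "sound \<tau> ?H s R"
    unfolding sound_def
  proof (intro allI impI, elim conjE)
    fix \<epsilon> :: real and A assume \<epsilon>: "0 < \<epsilon>" and A: "is_struct \<tau> A" "far \<tau> \<epsilon> A ?H"
    have "far \<tau> \<epsilon> A P" using far_subset[OF A(2) subset_rejection_free[OF assms]] .
    hence "2 / 3 \<le> pmf (verdict P (s \<epsilon>) (R \<epsilon>) A) False"
      using assms(2) \<epsilon> A by (simp add: one_sided_tester_def sound_def)
    moreover have "A \<notin> ?H" using far_not_mem[OF A(2)] \<epsilon> by simp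
    ultimately show "2 / 3 \<le> pmf (verdict ?H (s \<epsilon>) (R \<epsilon>) A) False"
      by (cases "s \<epsilon> \<le> card (verts A)") (auto simp: verdict_def)
  qed
  ultimately show ?thesis using assms(2) by (simp add: one_sided_tester_def)
qed

text \<open>
  The rejected samples of a far input form a hypergraph of density at least \<open>2 / 3\<close>, and the
  sets inducing rejection-free structures are independent in it.  The fingerprints there are
  sets; listing them in increasing order makes them tuples.
\<close>

lemma container_rejection_free:
  assumes "is_property \<tau> P" "one_sided_tester \<tau> P s R" and \<epsilon>: "0 < \<epsilon>" "0 < s \<epsilon>"
  shows "ordered_container_lemma \<tau> (rejection_free \<tau> s R) \<epsilon>
    (2 / (3 * real (s \<epsilon>))) (s \<epsilon>) (s \<epsilon> - 1)"
proof -
  let ?H = "rejection_free \<tau> s R"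
  let ?\<eta> = "2 / (3 * real (s \<epsilon>))"
  have "\<exists>f C. f \<in> D \<rightarrow> {t. distinct t \<and> set t \<subseteq> verts A \<and> length t \<le> s \<epsilon> - 1} \<and>
      C \<in> f ` D \<rightarrow> {W. W \<subseteq> verts A \<and> real (card W) \<le> (1 - ?\<eta>) * real (card (verts A))} \<and>
      (\<forall>U\<in>D. set (f U) \<subseteq> U \<and> U \<subseteq> C (f U))"
    if A: "is_struct \<tau> A" "s \<epsilon> \<le> card (verts A)" "far \<tau> \<epsilon> A ?H"
      and D: "D = {U. U \<subseteq> verts A \<and> induced A U \<in> ?H}" for A D
  proof -
    define F where "F = {S. S \<subseteq> verts A \<and> card S = s \<epsilon> \<and> induced A S \<in> R \<epsilon>}"
    have fin: "finite (verts A)" using A(1) by (simp add: is_struct_def)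
    have "2 / 3 \<le> pmf (verdict P (s \<epsilon>) (R \<epsilon>) A) False"
      using assms(2) \<epsilon> A far_subset[OF A(3) subset_rejection_free[OF assms(1,2)]]
      by (simp add: one_sided_tester_def sound_def)
    also have "\<dots> = real (card F) / real (card (verts A) choose s \<epsilon>)"
      unfolding pmf_verdict[OF fin A(2)] by (simp add: F_def)
    finally have dense: "2 / 3 * real (card (verts A) choose s \<epsilon>) \<le> real (card F)"
      using A(2) by (simp add: field_simps)
    obtain g C where gC: "\<And>U. U \<subseteq> verts A \<Longrightarrow> (\<And>S. S \<in> F \<Longrightarrow> \<not> S \<subseteq> U) \<Longrightarrow>
        g U \<subseteq> U \<and> card (g U) < s \<epsilon> \<and> U \<subseteq> C (g U) \<and> C (g U) \<subseteq> verts A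
        \<and> real (card (C (g U))) \<le> (1 - (2 / 3) / real (s \<epsilon>)) * real (card (verts A))"
    proof (rule dense_hypergraph_containers[OF fin \<epsilon>(2) A(2) _ dense])
      show "F \<subseteq> {S. S \<subseteq> verts A \<and> card S = s \<epsilon>}" by (auto simp: F_def)
    qed (simp, blast)
    have props: "g U \<subseteq> U \<and> card (g U) < s \<epsilon> \<and> U \<subseteq> C (g U) \<and> C (g U) \<subseteq> verts A
        \<and> real (card (C (g U))) \<le> (1 - ?\<eta>) * real (card (verts A))
        \<and> finite (g U) \<and> U \<subseteq> verts A" if "U \<in> D" for U
    proof -
      have U: "U \<subseteq> verts A" "induced A U \<in> ?H" using that by (auto simp: D)
      have "\<not> S \<subseteq> U" if "S \<in> F" for S
      proof
        assume "S \<subseteq> U"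
        hence "induced A S \<notin> R \<epsilon>"
          using U(2) \<epsilon>(1) that induced_induced[of S U A]
          by (auto simp: F_def rejection_free_def dest!: spec[of _ \<epsilon>] spec[of _ S])
        thus False using that by (simp add: F_def)
      qed
      note g = gC[OF U(1) this]
      hence "finite (g U)" using U(1) fin by (meson finite_subset)
      thus ?thesis using U(1) g by simp
    qed
    show ?thesis
    proof (intro exI[of _ "\<lambda>U. sorted_list_of_set (g U)"] exI[of _ "\<lambda>t. C (set t)"] conjI)
      show "(\<lambda>U. sorted_list_of_set (g U))
          \<in> D \<rightarrow> {t. distinct t \<and> set t \<subseteq> verts A \<and> length t \<le> s \<epsilon> - 1}"
        using props by fastforce
      show "(\<lambda>t. C (set t)) \<in> (\<lambda>U. sorted_list_of_set (g U)) ` D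
          \<rightarrow> {W. W \<subseteq> verts A \<and> real (card W) \<le> (1 - ?\<eta>) * real (card (verts A))}"
        by (intro funcsetI, elim imageE) (use props in simp)
      show "\<forall>U\<in>D. set (sorted_list_of_set (g U)) \<subseteq> U \<and> U \<subseteq> C (set (sorted_list_of_set (g U)))"
        using props by simp
    qed
  qed
  thus ?thesis
    using \<epsilon> by (simp add: ordered_container_lemma_def Let_def)
qed

section \<open>Few samples are covered by containers\<close>

text \<open>
  Drawing \<open>m\<close> elements from a \<open>b\<close>-set without replacement, the chance of staying inside an
  \<open>a\<close>-subset is at most that of drawing with replacement: each success makes the next one less
  likely, since \<open>a - 1 \<le> \<theta> * (b - 1)\<close> for \<open>\<theta> \<le> 1\<close>.
\<close>

lemma binomial_le_power_mult_binomial: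
  fixes \<theta> :: real
  assumes "real a \<le> \<theta> * real b" "0 \<le> \<theta>" "\<theta> \<le> 1"
  shows "real (a choose m) \<le> \<theta> ^ m * real (b choose m)"
  using assms(1)
proof (induction m arbitrary: a b)
  case 0
  show ?case by simp
next
  case (Suc m)
  show ?case
  proof (cases a)
    case 0
    thus ?thesis using assms(2) by simp
  next
    case a: (Suc a')
    then obtain b' where b: "b = Suc b'" using Suc.prems assms(2) by (cases b) auto
    have IH: "real (a' choose m) \<le> \<theta> ^ m * real (b' choose m)"
      using Suc.prems assms(3) a b by (intro Suc.IH) (simp add: algebra_simps)
    have "real (Suc m) * real (a choose Suc m) = real a * real (a' choose m)"
      using Suc_times_binomial_eq[of a' m] a by (simp only: of_nat_mult[symmetric] mult.commute)
    also have "\<dots> \<le> (\<theta> * real b) * (\<theta> ^ m * real (b' choose m))"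
      using Suc.prems IH assms(2) by (intro mult_mono) auto
    also have "\<dots> = \<theta> ^ Suc m * (real b * real (b' choose m))" by simp
    also have "real b * real (b' choose m) = real (Suc m) * real (b choose Suc m)"
      using Suc_times_binomial_eq[of b' m] b by (simp only: of_nat_mult[symmetric] mult.commute)
    finally have "real (Suc m) * real (a choose Suc m)
        \<le> real (Suc m) * (\<theta> ^ Suc m * real (b choose Suc m))" by (simp only: mult_ac)
    thus ?thesis by (simp only: mult_le_cancel_left_pos of_nat_0_less_iff zero_less_Suc)
  qed
qed

lemma card_subsets_between:
  assumes "finite W" "T \<subseteq> W" "card T \<le> s"
  shows "card {S. T \<subseteq> S \<and> S \<subseteq> W \<and> card S = s} = (card W - card T) choose (s - card T)"
proof -
  have finT: "finite T" using assms finite_subset by auto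
  have "bij_betw (\<lambda>S. S - T) {S. T \<subseteq> S \<and> S \<subseteq> W \<and> card S = s}
      {X. X \<subseteq> W - T \<and> card X = s - card T}"
  proof (rule bij_betw_byWitness[where f' = "\<lambda>X. X \<union> T"])
    show "(\<lambda>S. S - T) ` {S. T \<subseteq> S \<and> S \<subseteq> W \<and> card S = s}
        \<subseteq> {X. X \<subseteq> W - T \<and> card X = s - card T}"
      using finT by (auto simp: card_Diff_subset)
    show "(\<lambda>X. X \<union> T) ` {X. X \<subseteq> W - T \<and> card X = s - card T}
        \<subseteq> {S. T \<subseteq> S \<and> S \<subseteq> W \<and> card S = s}"
    proof clarsimp
      fix X assume X: "X \<subseteq> W - T" "card X = s - card T"
      hence "finite X" "X \<inter> T = {}" using assms(1) finite_subset by auto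
      thus "X \<subseteq> W \<and> T \<subseteq> W \<and> card (X \<union> T) = s"
        using X assms(2,3) finT by (auto simp: card_Un_disjoint)
    qed
  qed auto
  thus ?thesis
    using assms finT n_subsets[of "W - T" "s - card T"]
    by (simp add: bij_betw_same_card card_Diff_subset)
qed

lemma card_subsets_between_le:
  assumes "finite V" "T \<subseteq> C" "C \<subseteq> V" "card T \<le> s"
    and C: "real (card C) \<le> (1 - \<eta>) * real (card V)" and \<eta>: "0 < \<eta>" "\<eta> \<le> 1"
  shows "real (card {S. T \<subseteq> S \<and> S \<subseteq> C \<and> card S = s})
    \<le> exp (- \<eta> * (real s - real (card T))) * real (card {S. T \<subseteq> S \<and> S \<subseteq> V \<and> card S = s})"
proof -
  have fin: "finite C" using assms finite_subset by blast
  have le: "card T \<le> card C" "card C \<le> card V" using assms fin by (auto intro: card_mono)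
  have "real (card C - card T) \<le> (1 - \<eta>) * real (card V - card T)"
  proof -
    have "0 \<le> \<eta> * real (card T)" using \<eta> by simp
    thus ?thesis using C le by (simp add: of_nat_diff algebra_simps)
  qed
  hence "real ((card C - card T) choose (s - card T))
      \<le> (1 - \<eta>) ^ (s - card T) * real ((card V - card T) choose (s - card T))"
    using \<eta> by (intro binomial_le_power_mult_binomial) auto
  also have "(1 - \<eta>) ^ (s - card T) \<le> exp (- \<eta>) ^ (s - card T)"
    using \<eta> exp_ge_add_one_self[of "- \<eta>"] by (intro power_mono) auto
  also have "exp (- \<eta>) ^ (s - card T) = exp (- \<eta> * (real s - real (card T)))"
    using assms(4) by (simp add: exp_of_nat_mult[symmetric] of_nat_diff mult.commute)
  finally show ?thesis
    using assms fin by (simp add: card_subsets_between mult_right_mono)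
qed

text \<open>
  A union bound over the fingerprints \<open>t\<close>.  Bounding the samples between \<open>t\<close> and its container
  by a multiple of the samples containing \<open>t\<close>, and then exchanging the order of summation,
  replaces the number of fingerprints in \<open>V\<close> by the number of tuples in one sample, which does
  not depend on the size of \<open>V\<close>.
\<close>

lemma card_covered_samples_le:
  fixes s q :: nat and \<eta> :: real
  assumes V: "finite V" and \<eta>: "0 < \<eta>" "\<eta> \<le> 1"
    and f: "\<And>U. U \<in> D \<Longrightarrow> distinct (f U) \<and> length (f U) \<le> q \<and> set (f U) \<subseteq> U"
    and C: "\<And>U. U \<in> D \<Longrightarrow> U \<subseteq> C (f U) \<and> C (f U) \<subseteq> V
      \<and> real (card (C (f U))) \<le> (1 - \<eta>) * real (card V)"
  shows "real (card {S \<in> D. S \<subseteq> V \<and> card S = s})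
    \<le> (\<Sum>j\<le>q. real s ^ j * exp (- \<eta> * (real s - real j))) * real (card V choose s)"
proof -
  define \<Omega> where "\<Omega> = {S. S \<subseteq> V \<and> card S = s}"
  define L where "L = {t. set t \<subseteq> V \<and> length t \<le> q}"
  define w where "w t = exp (- \<eta> * (real s - real (length t)))" for t :: "'a list"
  define I where "I = f ` {S \<in> D. S \<in> \<Omega>}"
  have fin\<Omega>: "finite \<Omega>" using V by (simp add: \<Omega>_def finite_subset[of _ "Pow V"] subset_iff)
  have finL: "finite L" unfolding L_def using V by (rule finite_lists_length_le)
  have finS: "finite S" if "S \<in> \<Omega>" for S using that V finite_subset by (auto simp: \<Omega>_def)
  have I: "I \<subseteq> L" using f by (fastforce simp: I_def L_def \<Omega>_def)
  hence finI: "finite I" using finL finite_subset by blast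
  have "real (card {S \<in> D. S \<in> \<Omega>})
      \<le> real (card (\<Union>t\<in>I. {S. set t \<subseteq> S \<and> S \<subseteq> C t \<and> card S = s}))"
  proof -
    have "finite (\<Union>t\<in>I. {S. set t \<subseteq> S \<and> S \<subseteq> C t \<and> card S = s})"
      by (rule finite_subset[OF _ fin\<Omega>]) (use C in \<open>fastforce simp: I_def \<Omega>_def\<close>)
    moreover have "{S \<in> D. S \<in> \<Omega>} \<subseteq> (\<Union>t\<in>I. {S. set t \<subseteq> S \<and> S \<subseteq> C t \<and> card S = s})"
    proof
      fix S assume S: "S \<in> {S \<in> D. S \<in> \<Omega>}"
      hence "f S \<in> I" "S \<in> {S'. set (f S) \<subseteq> S' \<and> S' \<subseteq> C (f S) \<and> card S' = s}"
        using f C by (auto simp: I_def \<Omega>_def)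
      thus "S \<in> (\<Union>t\<in>I. {S. set t \<subseteq> S \<and> S \<subseteq> C t \<and> card S = s})" by blast
    qed
    ultimately show ?thesis by (intro of_nat_mono card_mono)
  qed
  also have "\<dots> \<le> (\<Sum>t\<in>I. real (card {S. set t \<subseteq> S \<and> S \<subseteq> C t \<and> card S = s}))"
    using card_UN_le[OF finI, of "\<lambda>t. {S. set t \<subseteq> S \<and> S \<subseteq> C t \<and> card S = s}"]
    by (simp only: of_nat_sum[symmetric] of_nat_le_iff)
  also have "\<dots> \<le> (\<Sum>t\<in>I. w t * real (card {S \<in> \<Omega>. set t \<subseteq> S}))"
  proof (rule sum_mono)
    fix t assume "t \<in> I"
    then obtain U where U: "U \<in> D" "U \<in> \<Omega>" "t = f U" by (auto simp: I_def)
    have ct: "card (set t) = length t" using f[OF U(1)] U(3) by (simp add: distinct_card)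
    have "card (set t) \<le> s"
      using f[OF U(1)] U finS[of U] card_mono[of U "set t"] by (auto simp: \<Omega>_def)
    moreover have "{S. set t \<subseteq> S \<and> S \<subseteq> V \<and> card S = s} = {S \<in> \<Omega>. set t \<subseteq> S}"
      by (auto simp: \<Omega>_def)
    moreover have "set t \<subseteq> C t" "C t \<subseteq> V" "real (card (C t)) \<le> (1 - \<eta>) * real (card V)"
      using f[OF U(1)] C[OF U(1)] U(3) by auto
    ultimately show "real (card {S. set t \<subseteq> S \<and> S \<subseteq> C t \<and> card S = s})
        \<le> w t * real (card {S \<in> \<Omega>. set t \<subseteq> S})"
      using card_subsets_between_le[OF V, of "set t" "C t" s \<eta>] \<eta> by (simp add: w_def ct)
  qed
  also have "\<dots> \<le> (\<Sum>t\<in>L. w t * real (card {S \<in> \<Omega>. set t \<subseteq> S}))"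
    using finL I by (intro sum_mono2) (auto simp: w_def)
  also have "\<dots> = (\<Sum>t\<in>L. \<Sum>S\<in>\<Omega>. if set t \<subseteq> S then w t else 0)"
    using fin\<Omega> by (simp add: sum.If_cases Int_def mult.commute)
  also have "\<dots> = (\<Sum>S\<in>\<Omega>. \<Sum>t\<in>L. if set t \<subseteq> S then w t else 0)"
    by (rule sum.swap)
  also have "\<dots> = (\<Sum>S\<in>\<Omega>. \<Sum>j\<le>q. real s ^ j * exp (- \<eta> * (real s - real j)))"
  proof (rule sum.cong[OF refl])
    fix S assume S: "S \<in> \<Omega>"
    have "(\<Sum>t\<in>L. if set t \<subseteq> S then w t else 0) = sum w {t \<in> L. set t \<subseteq> S}"
      using finL by (simp add: sum.If_cases Int_def)
    also have "\<dots> = (\<Sum>j\<le>q. sum w {t \<in> {t \<in> L. set t \<subseteq> S}. length t = j})"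
      using finL by (intro sum.group[symmetric] finite_Collect_conjI disjI1) (auto simp: L_def)
    also have "\<dots> = (\<Sum>j\<le>q. real s ^ j * exp (- \<eta> * (real s - real j)))"
    proof (rule sum.cong[OF refl])
      fix j assume "j \<in> {..q}"
      hence "{t \<in> {t \<in> L. set t \<subseteq> S}. length t = j} = {t. set t \<subseteq> S \<and> length t = j}"
        using S by (auto simp: L_def \<Omega>_def)
      moreover have "card {t. set t \<subseteq> S \<and> length t = j} = s ^ j"
        using card_lists_length_eq[OF finS[OF S], of j] S by (simp add: \<Omega>_def)
      ultimately show "sum w {t \<in> {t \<in> L. set t \<subseteq> S}. length t = j}
          = real s ^ j * exp (- \<eta> * (real s - real j))"
        by (simp add: w_def)
    qed
    finally show "(\<Sum>t\<in>L. if set t \<subseteq> S then w t else 0)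
        = (\<Sum>j\<le>q. real s ^ j * exp (- \<eta> * (real s - real j)))" .
  qed
  also have "\<dots> = (\<Sum>j\<le>q. real s ^ j * exp (- \<eta> * (real s - real j))) * real (card V choose s)"
    using V by (simp add: \<Omega>_def n_subsets mult.commute)
  finally show ?thesis by (simp add: \<Omega>_def conj_assoc)
qed

lemma ln_plus_2_ge_1:
  assumes "1 \<le> (y::real)"
  shows "1 \<le> ln (y + 2)"
  using assms exp_le by (subst ln_ge_iff) auto

text \<open>
  Write \<open>y = (q + 1) / \<eta>\<close> and \<open>L = ln (y + 2)\<close>.  The crucial term is \<open>q * ln s\<close>.  The tangent bound
  \<open>ln x \<le> x - 1\<close> at \<open>x = s / (2 * y)\<close> splits it into at most \<open>\<eta> * s / 2\<close> and at most \<open>q * L\<close>,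
  for every \<open>s\<close> and not only for \<open>s\<close> of the order of the lower bound.  The remaining half of
  \<open>\<eta> * s\<close> has to absorb \<open>ln 3 + ln (q + 1) + \<eta> * q + q * L \<le> 2 * (q + 1) * L\<close>, hence the factor
  \<open>4\<close>.
\<close>

lemma union_bound_le_third:
  fixes s q :: nat and \<eta> :: real
  assumes \<eta>: "0 < \<eta>" "\<eta> \<le> 1"
    and s: "4 * ((real q + 1) / \<eta> * ln ((real q + 1) / \<eta> + 2)) \<le> real s"
  shows "(\<Sum>j\<le>q. real s ^ j * exp (- \<eta> * (real s - real j))) \<le> 1 / 3"
proof -
  define y where "y = (real q + 1) / \<eta>"
  define L where "L = ln (y + 2)"
  have y2: "real q + 1 \<le> y"
    using mult_right_mono[OF \<eta>(2), of "real q + 1"] \<eta>(1) by (simp add: y_def field_simps)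
  hence y: "1 \<le> y" "real q + 1 \<le> y" by auto
  have L1: "1 \<le> L" unfolding L_def using y(1) by (rule ln_plus_2_ge_1)
  have s': "4 * ((real q + 1) * L) \<le> \<eta> * real s"
    using s \<eta> by (simp add: L_def y_def field_simps)
  have "1 * 1 \<le> y * L" using y L1 by (intro mult_mono) auto
  hence s1: "1 \<le> real s" using s by (simp add: y_def L_def)
  have "ln (real s) \<le> real s / (2 * y) + L"
  proof -
    have "ln (real s / (2 * y)) \<le> real s / (2 * y) - 1"
      using y s1 by (intro ln_le_minus_one) auto
    moreover have "ln (real s / (2 * y)) = ln (real s) - ln 2 - ln y"
      using y s1 by (simp add: ln_div ln_mult)
    moreover have "ln (2::real) \<le> 1" using ln_le_minus_one[of "2::real"] by simp
    moreover have "ln y \<le> L" using y by (simp add: L_def)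
    ultimately show ?thesis by linarith
  qed
  hence "real q * ln (real s) \<le> real q * (real s / (2 * y)) + real q * L"
    by (metis distrib_left mult_left_mono of_nat_0_le_iff)
  also have "real q * (real s / (2 * y)) \<le> \<eta> * real s / 2"
    using \<eta> by (simp add: y_def field_simps)
  finally have qln: "real q * ln (real s) \<le> \<eta> * real s / 2 + real q * L" by simp
  have "real s ^ j * exp (- \<eta> * (real s - real j)) \<le> 1 / (3 * (real q + 1))" if "j \<le> q" for j
  proof -
    have "real s ^ j * exp (- \<eta> * (real s - real j))
        = exp (real j * ln (real s) - \<eta> * real s + \<eta> * real j)"
      using s1 by (simp add: exp_add exp_diff exp_of_nat_mult exp_minus field_simps)
    also have "\<dots> \<le> exp (- (ln 3 + ln (real q + 1)))"
    proof -
      have "real j * ln (real s) \<le> real q * ln (real s)"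
        using that s1 by (intro mult_right_mono) auto
      moreover have "\<eta> * real j \<le> 1 * real q" using \<eta> that by (intro mult_mono) auto
      moreover have "1 * real q \<le> L * real q" using L1 by (intro mult_right_mono) auto
      moreover have "ln 3 \<le> L" "ln (real q + 1) \<le> L" using y by (auto simp: L_def)
      ultimately have "real j * ln (real s) - \<eta> * real s + \<eta> * real j
          \<le> - (ln 3 + ln (real q + 1)) + (2 * ((real q + 1) * L) - \<eta> * real s / 2)"
        using qln by (simp add: algebra_simps)
      thus ?thesis using s' by simp
    qed
    also have "\<dots> = 1 / (3 * (real q + 1))"
      by (simp only: exp_minus exp_add) (simp add: field_simps)
    finally show ?thesis .
  qed
  hence "(\<Sum>j\<le>q. real s ^ j * exp (- \<eta> * (real s - real j))) \<le> (\<Sum>j\<le>q. 1 / (3 * (real q + 1)))"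
    by (intro sum_mono) auto
  also have "\<dots> = 1 / 3" by (simp add: field_simps)
  finally show ?thesis .
qed

section \<open>From a witness with containers to a tester\<close>

definition forbidden :: "signature \<Rightarrow> rel_struct set \<Rightarrow> nat \<Rightarrow> rel_struct set" where
  "forbidden \<tau> H k = {A. is_struct \<tau> A \<and> card (verts A) = k \<and> A \<notin> H}"

text \<open>
  Non-membership in \<open>H\<close> is invariant under isomorphism because isomorphism is symmetric.
\<close>

lemma is_property_forbidden:
  assumes "is_property \<tau> H"
  shows "is_property \<tau> (forbidden \<tau> H k)"
  unfolding is_property_def
proof (intro conjI ballI allI impI, goal_cases)
  case (1 A)
  thus ?case by (simp add: forbidden_def)
next
  case (2 A B)
  hence A: "is_struct \<tau> A" "A \<notin> H" "card (verts A) = k" and B: "is_struct \<tau> B" "isomorphic A B"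
    by (auto simp: forbidden_def)
  have "B \<notin> H"
    using is_property_isomorphic[OF assms _ A(1) isomorphic_sym[OF A(1) B(2)]] A(2) by blast
  moreover have "card (verts B) = k"
    using A(3) B(2) by (auto simp: isomorphic_def dest: bij_betw_same_card)
  ultimately show ?case using B by (simp add: forbidden_def)
qed

lemma ordered_container_lemma_pos:
  assumes "ordered_container_lemma \<tau> H \<epsilon> \<eta> N q"
  shows "0 < \<epsilon>" "0 < \<eta>"
  using assms[unfolded ordered_container_lemma_def, THEN conjunct1]
    assms[unfolded ordered_container_lemma_def, THEN conjunct2, THEN conjunct1] by auto

text \<open>
  If \<open>\<eta> > 1\<close> the containers would have negative size, so no set at all induces a member of \<open>H\<close>
  (the empty input is a member of \<open>H\<close> as soon as it has such a set, and then it is not far).  The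
  sample size is therefore constrained only for \<open>\<eta> \<le> 1\<close>.
\<close>

lemma far_few_hereditary_samples:
  assumes cont: "ordered_container_lemma \<tau> H \<epsilon> \<eta> N q"
    and A: "is_struct \<tau> A" "far \<tau> \<epsilon> A H"
    and s: "N \<le> card (verts A)"
      "\<eta> \<le> 1 \<Longrightarrow> 4 * ((real q + 1) / \<eta> * ln ((real q + 1) / \<eta> + 2)) \<le> real s"
  shows "real (card {S. S \<subseteq> verts A \<and> card S = s \<and> induced A S \<in> H})
    \<le> 1 / 3 * real (card (verts A) choose s)"
proof -
  define V where "V = verts A"
  define D where "D = {U. U \<subseteq> V \<and> induced A U \<in> H}"
  have fin: "finite V" using A(1) by (simp add: is_struct_def V_def)
  note \<epsilon>\<eta> = ordered_container_lemma_pos[OF cont]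
  have "is_struct \<tau> A \<and> N \<le> card (verts A) \<and> far \<tau> \<epsilon> A H" using A s(1) by blast
  with cont[unfolded ordered_container_lemma_def Let_def, THEN conjunct2, THEN conjunct2,
      THEN spec[of _ A]]
  have "\<exists>f C. f \<in> D \<rightarrow> {t. distinct t \<and> set t \<subseteq> V \<and> length t \<le> q} \<and>
      C \<in> f ` D \<rightarrow> {W. W \<subseteq> V \<and> real (card W) \<le> (1 - \<eta>) * real (card V)} \<and>
      (\<forall>U\<in>D. set (f U) \<subseteq> U \<and> U \<subseteq> C (f U))"
    unfolding D_def V_def by (rule mp)
  then obtain f C where f: "f \<in> D \<rightarrow> {t. distinct t \<and> set t \<subseteq> V \<and> length t \<le> q}"
    and C: "C \<in> f ` D \<rightarrow> {W. W \<subseteq> V \<and> real (card W) \<le> (1 - \<eta>) * real (card V)}"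
    and U: "\<forall>U\<in>D. set (f U) \<subseteq> U \<and> U \<subseteq> C (f U)"
    by (elim exE conjE)
  have f': "distinct (f U) \<and> length (f U) \<le> q \<and> set (f U) \<subseteq> U" if "U \<in> D" for U
    using f U that by auto
  have C': "U \<subseteq> C (f U) \<and> C (f U) \<subseteq> V \<and> real (card (C (f U))) \<le> (1 - \<eta>) * real (card V)"
    if "U \<in> D" for U
    using C U that by auto
  have eq: "{S. S \<subseteq> verts A \<and> card S = s \<and> induced A S \<in> H} = {S \<in> D. S \<subseteq> V \<and> card S = s}"
    by (auto simp: D_def V_def)
  show ?thesis
  proof (cases "\<eta> \<le> 1")
    case True
    have "real (card {S \<in> D. S \<subseteq> V \<and> card S = s})
        \<le> (\<Sum>j\<le>q. real s ^ j * exp (- \<eta> * (real s - real j))) * real (card V choose s)"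
      using card_covered_samples_le[OF fin \<epsilon>\<eta>(2) True f' C'] by blast
    also have "\<dots> \<le> 1 / 3 * real (card V choose s)"
      using union_bound_le_third[OF \<epsilon>\<eta>(2) True s(2)[OF True]] by (intro mult_right_mono) auto
    finally show ?thesis by (simp only: eq V_def)
  next
    case False
    have "D = {}"
    proof (rule ccontr)
      assume "D \<noteq> {}"
      then obtain U where U: "U \<in> D" by blast
      have "0 \<le> (1 - \<eta>) * real (card V)" using C'[OF U] of_nat_0_le_iff order_trans by blast
      hence "card V = 0" using False by (simp add: zero_le_mult_iff)
      hence "verts A = {}" using fin by (simp add: V_def)
      hence "induced A (verts A) \<in> H" using U by (auto simp: D_def V_def)
      hence "A \<in> H" using induced_verts[OF A(1)] by simp
      thus False using far_not_mem[OF A(2)] \<epsilon>\<eta>(1) by simp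
    qed
    thus ?thesis by (simp add: eq)
  qed
qed

lemma pmf_verdict_forbidden:
  assumes witness: "semi_hereditary_witness \<tau> P H M" and P: "is_property \<tau> P"
    and A: "A \<in> P"
  shows "pmf (verdict P k (forbidden \<tau> H k) A) True = 1"
proof (cases "k \<le> card (verts A)")
  case True
  have "A \<in> H" "hereditary \<tau> H"
    using semi_hereditary_witnessD(1,2)[OF witness] A by auto
  hence "induced A S \<notin> forbidden \<tau> H k" if "S \<subseteq> verts A" for S
    using that hereditary_induced by (auto simp: forbidden_def)
  moreover have "finite (verts A)"
    using is_property_is_struct[OF P A] by (simp add: is_struct_def)
  ultimately show ?thesis using True by (simp add: pmf_verdict_True_eq_1_iff)
next
  case False
  thus ?thesis using A by (simp add: verdict_def)
qed

lemma forbidden_sound: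
  assumes witness: "semi_hereditary_witness \<tau> P H M" and P: "is_property \<tau> P"
    and cont: "ordered_container_lemma \<tau> H \<delta> \<eta> N q"
    and \<delta>: "\<delta> \<in> {0<..<1}"
    and s: "M \<delta> \<le> s" "N \<le> s"
      "\<eta> \<le> 1 \<Longrightarrow> 4 * ((real q + 1) / \<eta> * ln ((real q + 1) / \<eta> + 2)) \<le> real s"
    and A: "is_struct \<tau> A" "far \<tau> (2 * \<delta>) A P"
  shows "2 / 3 \<le> pmf (verdict P s (forbidden \<tau> H s) A) False"
proof (cases "s \<le> card (verts A)")
  case True
  let ?n = "card (verts A)"
  have fin: "finite (verts A)" using A(1) by (simp add: is_struct_def)
  have farH: "far \<tau> \<delta> A H"
    using far_witness_half[OF witness P A(1) _ A(2) \<delta>] s(1) True by simp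
  have "{S. S \<subseteq> verts A \<and> card S = s \<and> (induced A S \<notin> forbidden \<tau> H s) = True}
      = {S. S \<subseteq> verts A \<and> card S = s \<and> induced A S \<in> H}"
    using is_struct_induced[OF A(1)] by (auto simp: forbidden_def)
  hence "pmf (verdict P s (forbidden \<tau> H s) A) True
      = real (card {S. S \<subseteq> verts A \<and> card S = s \<and> induced A S \<in> H}) / real (?n choose s)"
    by (simp only: pmf_verdict[OF fin True])
  also have "\<dots> \<le> 1 / 3"
    using far_few_hereditary_samples[OF cont A(1) farH _ s(3)] s(2) True
    by (simp add: divide_le_eq)
  finally show ?thesis by (simp add: pmf_False_conv_True)
next
  case False
  have "A \<notin> P" using far_not_mem[OF A(2)] \<delta> by simp
  thus ?thesis using False by (simp add: verdict_def)
qed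

text \<open>
  For \<open>\<epsilon> \<ge> 2\<close> the witness says nothing about \<open>\<epsilon> / 2\<close>, so the tester for distance \<open>1\<close> is
  reused; it is sound since an \<open>\<epsilon>\<close>-far input is also \<open>1\<close>-far.
\<close>

lemma tester_of_containers:
  assumes P: "is_property \<tau> P" and witness: "semi_hereditary_witness \<tau> P H M"
    and cont: "\<And>\<epsilon>. 0 < \<epsilon> \<Longrightarrow> ordered_container_lemma \<tau> H \<epsilon> (\<eta> \<epsilon>) (N \<epsilon>) (q \<epsilon>)"
  defines "X \<equiv> \<lambda>\<delta>. (real (q \<delta>) + 1) / \<eta> \<delta> * ln ((real (q \<delta>) + 1) / \<eta> \<delta> + 2)"
  shows "\<exists>s R. one_sided_tester \<tau> P s R \<and>
    (\<forall>\<epsilon>\<in>{0<..<2}. real (s \<epsilon>) \<le> 5 * Max {real (M (\<epsilon> / 2)), real (N (\<epsilon> / 2)), X (\<epsilon> / 2)})"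
proof -
  \<comment> \<open>Rounding down keeps the last term at most \<open>5 * X\<close> even when \<open>X\<close> is tiny, which happens only
      for \<open>\<eta> > 1\<close>.  For \<open>\<eta> \<le> 1\<close> one has \<open>X \<ge> 1\<close>, and the result is still at least \<open>4 * X\<close>.\<close>
  define r where "r \<delta> = max (max (M \<delta>) (N \<delta>)) (nat \<lfloor>5 * X \<delta>\<rfloor>)" for \<delta>
  define half where "half \<epsilon> = (if \<epsilon> < 2 then \<epsilon> / 2 else 1 / 2)" for \<epsilon> :: real
  define s where "s \<epsilon> = r (half \<epsilon>)" for \<epsilon>
  define R where "R \<epsilon> = forbidden \<tau> H (s \<epsilon>)" for \<epsilon>
  have \<eta>: "0 < \<eta> \<delta>" if "0 < \<delta>" for \<delta>
    using cont[OF that] by (rule ordered_container_lemma_pos)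
  have X0: "0 \<le> X \<delta>" if "0 < \<delta>" for \<delta>
    using \<eta>[OF that] unfolding X_def by (intro mult_nonneg_nonneg ln_ge_zero) auto
  have X1: "1 \<le> X \<delta>" if "0 < \<delta>" "\<eta> \<delta> \<le> 1" for \<delta>
  proof -
    have y: "1 \<le> (real (q \<delta>) + 1) / \<eta> \<delta>" using \<eta>[OF that(1)] that(2) by (simp add: le_divide_eq)
    have "1 * 1 \<le> X \<delta>"
      unfolding X_def using y ln_plus_2_ge_1[OF y] by (intro mult_mono) auto
    thus ?thesis by simp
  qed
  have "sound \<tau> P s R"
    unfolding sound_def
  proof (intro allI impI, elim conjE)
    fix \<epsilon> :: real and A assume \<epsilon>: "0 < \<epsilon>" and A: "is_struct \<tau> A" "far \<tau> \<epsilon> A P"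
    define \<delta> where "\<delta> = half \<epsilon>"
    have \<delta>: "\<delta> \<in> {0<..<1}" "2 * \<delta> \<le> \<epsilon>" using \<epsilon> by (auto simp: \<delta>_def half_def)
    have "4 * X \<delta> \<le> real (r \<delta>)" if "\<eta> \<delta> \<le> 1"
    proof -
      have "4 * X \<delta> \<le> 5 * X \<delta> - 1" using X1[of \<delta>] that \<delta> by simp
      also have "\<dots> \<le> real (nat \<lfloor>5 * X \<delta>\<rfloor>)" by linarith
      also have "\<dots> \<le> real (r \<delta>)" by (simp add: r_def)
      finally show ?thesis .
    qed
    thus "2 / 3 \<le> pmf (verdict P (s \<epsilon>) (R \<epsilon>) A) False"
      unfolding R_def s_def \<delta>_def[symmetric]
      using \<delta> A(1) far_mono[OF A(2) \<delta>(2)]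
      by (intro forbidden_sound[OF witness P cont[of \<delta>]]) (auto simp: r_def X_def)
  qed
  moreover have "oblivious_tester \<tau> s R"
    using is_property_forbidden[OF hereditary_is_property[OF semi_hereditary_witnessD(1)[OF witness]]]
    by (simp add: oblivious_tester_def R_def) (simp add: forbidden_def)
  moreover have "one_sided_error P s R"
    using pmf_verdict_forbidden[OF witness P] by (simp add: one_sided_error_def R_def)
  moreover have "real (s \<epsilon>) \<le> 5 * Max {real (M (\<epsilon> / 2)), real (N (\<epsilon> / 2)), X (\<epsilon> / 2)}"
    if "\<epsilon> \<in> {0<..<2}" for \<epsilon>
  proof -
    have "real (nat \<lfloor>5 * X (\<epsilon> / 2)\<rfloor>) \<le> 5 * X (\<epsilon> / 2)"
      using X0[of "\<epsilon> / 2"] that by simp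
    moreover have "real (s \<epsilon>)
        = max (max (real (M (\<epsilon> / 2))) (real (N (\<epsilon> / 2)))) (real (nat \<lfloor>5 * X (\<epsilon> / 2)\<rfloor>))"
      using that by (simp add: s_def half_def r_def)
    moreover have "Max {real (M (\<epsilon> / 2)), real (N (\<epsilon> / 2)), X (\<epsilon> / 2)}
        = max (real (M (\<epsilon> / 2))) (max (real (N (\<epsilon> / 2))) (X (\<epsilon> / 2)))"
      by simp
    ultimately show ?thesis by linarith
  qed
  ultimately show ?thesis unfolding one_sided_tester_def by blast
qed

theorem theorem4p7:
  shows "(\<forall>\<tau> P s R.
            is_signature \<tau> \<and> is_property \<tau> P \<and> one_sided_tester \<tau> P s R \<longrightarrow>
            (\<exists>H M. semi_hereditary_witness \<tau> P H M \<and>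
                   (\<forall>\<epsilon>\<in>{0<..<1}. M \<epsilon> \<le> s \<epsilon>) \<and>
                   one_sided_tester \<tau> H s R \<and>
                   (\<forall>\<epsilon>>0. 0 < s \<epsilon> \<longrightarrow>
                      ordered_container_lemma \<tau> H \<epsilon> (2 / (3 * real (s \<epsilon>))) (s \<epsilon>) (s \<epsilon> - 1))))
       \<and>
         (\<exists>K::real. 0 < K \<and> (\<forall>\<tau> P H M \<eta> N q.
            is_signature \<tau> \<and> is_property \<tau> P \<and> semi_hereditary_witness \<tau> P H M \<and>
            (\<forall>\<epsilon>>0. ordered_container_lemma \<tau> H \<epsilon> (\<eta> \<epsilon>) (N \<epsilon>) (q \<epsilon>)) \<longrightarrow>
            (\<exists>s R. one_sided_tester \<tau> P s R \<and>
                   (\<forall>\<epsilon>\<in>{0<..<2}.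
                      real (s \<epsilon>) \<le> K * Max {real (M (\<epsilon> / 2)), real (N (\<epsilon> / 2)),
                        (real (q (\<epsilon> / 2)) + 1) / \<eta> (\<epsilon> / 2)
                          * ln ((real (q (\<epsilon> / 2)) + 1) / \<eta> (\<epsilon> / 2) + 2)}))))"
proof (rule conjI, goal_cases)
  case 1
  show ?case
  proof (intro allI impI, elim conjE)
    fix \<tau> P s R assume P: "is_property \<tau> P" "one_sided_tester \<tau> P s R"
    show "\<exists>H M. semi_hereditary_witness \<tau> P H M \<and> (\<forall>\<epsilon>\<in>{0<..<1}. M \<epsilon> \<le> s \<epsilon>) \<and>
        one_sided_tester \<tau> H s R \<and> (\<forall>\<epsilon>>0. 0 < s \<epsilon> \<longrightarrow>
          ordered_container_lemma \<tau> H \<epsilon> (2 / (3 * real (s \<epsilon>))) (s \<epsilon>) (s \<epsilon> - 1))"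
      using witness_rejection_free[OF P] tester_rejection_free[OF P] container_rejection_free[OF P]
      by (intro exI[of _ "rejection_free \<tau> s R"] exI[of _ s]) auto
  qed
next
  case 2
  show ?case
  proof (intro exI[of _ 5] conjI allI impI, goal_cases)
    case 1
    show ?case by simp
  next
    case (2 \<tau> P H M \<eta> N q)
    hence P: "is_property \<tau> P" and witness: "semi_hereditary_witness \<tau> P H M"
      and cont: "\<And>\<epsilon>. 0 < \<epsilon> \<Longrightarrow> ordered_container_lemma \<tau> H \<epsilon> (\<eta> \<epsilon>) (N \<epsilon>) (q \<epsilon>)"
      by blast+
    show ?case by (rule tester_of_containers[OF P witness cont])
  qed
qed

end
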